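(* Let $m,n\in\mathbb{N}$ with $m\ge n$. There is exactly one dimension-preserving graph morphism $T_m\to T_n$ that is surjective on vertices.
   Context: A graph is $(V,E)$ with $E\subseteq V\times V$; a graph morphism $(V,E)\to(V',E')$ is $f:V\to V'$ with $(s,t)\in E\Rightarrow(f(s),f(t))\in E'$, sending the edge $(s,t)$ to the edge $(f(s),f(t))$. The twisted $n$-cube $T_n$ has vertex set $\{0,1\}^n$ and edges: a loop at each vertex, and for each $i\in\{0,\dots,n-1\}$ and $y\in\{0,1\}^{n-1}$ an edge from $y_0\cdots y_{i-1}\,b\,y_i\cdots y_{n-2}$ to $y_0\cdots y_{i-1}\,(1-b)\,y_i\cdots y_{n-2}$, where $b=1$ if the number of zeros among $y_0,\dots,y_{i-1}$ is odd and $b=0$ otherwise. The dimension of a loop is "trivial"; the dimension of a non-loop edge joining vertices that differ in coordinate $i$ is $i$. A graph morphism $f:T_m\to T_n$ is dimension-preserving if for any two edges $e_1,e_2$ of $T_m$ of equal dimension, $f(e_1)$ and $f(e_2)$ have equal dimension. *)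

theory Defs
  imports "Graph_Theory.Pair_Digraph" "HOL-Library.FuncSet"
begin

text \<open>
  A graph (V, E) with E a subset of V * V is a \<^typ>\<open>'a pair_pre_digraph\<close> that satisfies
  \<^const>\<open>pair_wf_digraph\<close>. A morphism is a function on vertices. It is taken to be
  \<^const>\<open>undefined\<close> outside the vertex set of the source, so that equality of HOL functions is
  equality of maps between the vertex sets.
\<close>

definition graph_morphism ::
  "'a pair_pre_digraph \<Rightarrow> 'b pair_pre_digraph \<Rightarrow> ('a \<Rightarrow> 'b) \<Rightarrow> bool" where
  "graph_morphism G H f \<longleftrightarrow>
     f \<in> pverts G \<rightarrow>\<^sub>E pverts H \<and>
     (\<forall>s t. (s, t) \<in> parcs G \<longrightarrow> (f s, f t) \<in> parcs H)"

text \<open>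
  Vertices are bit strings, with \<^const>\<open>True\<close> for 1 and \<^const>\<open>False\<close> for 0. The string y has
  length n - 1; the bit inserted at position i is flipped along the edge, and it starts as 1 exactly
  if the number of zeros among the first i bits of y is odd.
\<close>

definition twisted_cube :: "nat \<Rightarrow> bool list pair_pre_digraph" where
  "twisted_cube n =
     \<lparr> pverts = {x. length x = n},
       parcs = {(x, x) | x. length x = n} \<union>
         {(take i y @ b # drop i y, take i y @ (\<not> b) # drop i y) | i y b.
            i < n \<and> length y = n - 1 \<and> b = odd (count_list (take i y) False)} \<rparr>"

text \<open>
  \<^const>\<open>None\<close> is the trivial dimension. On non-loop edges of a twisted cube the
  definite description is well-defined, see \<open>edge_dim_cube_edge\<close> below.
\<close>

definition edge_dim :: "bool list \<times> bool list \<Rightarrow> nat option" where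
  "edge_dim e =
     (if fst e = snd e then None
      else Some (THE i. i < length (fst e) \<and> fst e ! i \<noteq> snd e ! i))"

definition dimension_preserving :: "nat \<Rightarrow> (bool list \<Rightarrow> bool list) \<Rightarrow> bool" where
  "dimension_preserving m f \<longleftrightarrow>
     (\<forall>e\<^sub>1 \<in> parcs (twisted_cube m). \<forall>e\<^sub>2 \<in> parcs (twisted_cube m).
        edge_dim e\<^sub>1 = edge_dim e\<^sub>2 \<longrightarrow>
        edge_dim (map_prod f f e\<^sub>1) = edge_dim (map_prod f f e\<^sub>2))"

lemma pair_wf_digraph_twisted_cube: "pair_wf_digraph (twisted_cube n)"
  by unfold_locales (auto simp: twisted_cube_def)

lemma edge_dim_cube_edge:
  assumes "i \<le> length y"
  shows "edge_dim (take i y @ b # drop i y, take i y @ (\<not> b) # drop i y) = Some i"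
proof -
  have "(THE j. j < length (take i y @ b # drop i y) \<and>
           (take i y @ b # drop i y) ! j \<noteq> (take i y @ (\<not> b) # drop i y) ! j) = i"
    using assms by (intro the_equality) (auto simp: nth_append nth_Cons' split: if_splits)
  then show ?thesis
    by (simp add: edge_dim_def)
qed

end

theory Submission
  imports Defs
begin

text \<open>
  Every vertex \<open>x\<close> meets exactly one edge in each dimension \<open>i\<close>; let its phase at \<open>i\<close> tell whether
  \<open>x\<close> is the target of that edge. The phases determine \<open>x\<close>, and flipping the bit \<open>k\<close> of \<open>x\<close> changes
  the phase at \<open>i\<close> exactly if \<open>k \<le> i\<close>. A dimension-preserving morphism \<open>f\<close> induces a partial map
  \<open>\<phi>\<close> of dimensions, and if \<open>\<phi> i = j\<close> then the phase of \<open>f x\<close> at \<open>j\<close> is the phase of \<open>x\<close> at \<open>i\<close>.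
  Flipping the bit \<open>k\<close> on both sides of this equation shows that \<open>\<phi> k \<le> j\<close> if and only if \<open>k \<le> i\<close>.
  If \<open>f\<close> is surjective, then \<open>\<phi>\<close> reaches every dimension below \<open>n\<close>, so counting gives \<open>\<phi> j = j\<close> for
  \<open>j < n\<close>. Hence \<open>f x\<close> and the prefix of \<open>x\<close> of length \<open>n\<close> have the same phases and are equal.
\<close>

section \<open>Flips and phases of bit strings\<close>

definition flip :: "nat \<Rightarrow> bool list \<Rightarrow> bool list" where
  "flip i x = x[i := \<not> x ! i]"

text \<open>An edge in dimension \<open>i\<close> starts with the parity bit of the zeros before
  \<open>i\<close>, so a target is a vertex whose bit \<open>i\<close> differs from that
  parity.\<close>

definition phase :: "nat \<Rightarrow> bool list \<Rightarrow> bool" where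
  "phase i x \<longleftrightarrow> x ! i \<noteq> odd (count_list (take i x) False)"

lemma length_flip [simp]: "length (flip i x) = length x"
  by (simp add: flip_def)

lemma flip_flip [simp]: "flip i (flip i x) = x"
  by (cases "i < length x") (simp_all add: flip_def list_update_beyond)

lemma nth_flip: "i < length x \<Longrightarrow> flip k x ! i = (x ! i \<noteq> (k = i))"
  by (auto simp: flip_def nth_list_update)

lemma flip_neq: "i < length x \<Longrightarrow> flip i x \<noteq> x"
  by (metis nth_flip)

lemma take_flip: "i < n \<Longrightarrow> i < length x \<Longrightarrow> take n (flip i x) = flip i (take n x)"
  by (simp add: flip_def take_update_swap)

lemma take_flip_beyond: "n \<le> i \<Longrightarrow> take n (flip i x) = take n x"
  by (simp add: flip_def)

lemma odd_count_flip:
  "k < length x \<Longrightarrow> odd (count_list (flip k x) b) \<noteq> odd (count_list x b)"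
proof (induction x arbitrary: k)
  case (Cons a x)
  then show ?case
    by (cases k) (auto simp: flip_def)
qed simp

text \<open>The parity counts zeros strictly before \<open>i\<close>. It changes for
  \<open>k < i\<close>; for \<open>k = i\<close> only the bit changes, and for \<open>k > i\<close>
  neither does.\<close>

lemma phase_flip:
  assumes "i < length x"
  shows "phase i (flip k x) = (phase i x \<noteq> (k \<le> i))"
proof (cases "k < i")
  case True
  then show ?thesis
    using assms odd_count_flip [of k "take i x" False]
    by (auto simp: phase_def nth_flip take_flip)
next
  case False
  then show ?thesis
    using assms by (auto simp: phase_def nth_flip take_flip_beyond)
qed

lemma phase_take: "i < n \<Longrightarrow> phase i (take n x) = phase i x"
  by (simp add: phase_def min_def)

text \<open>Bits are recovered from left to right: once the prefixes agree, so do the parities, and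
  the phase then fixes the next bit.\<close>

lemma phase_eqI:
  assumes len: "length x = length y"
    and phase: "\<And>i. i < length x \<Longrightarrow> phase i x = phase i y"
  shows "x = y"
proof (rule nth_equalityI [OF len])
  fix i
  assume "i < length x"
  then show "x ! i = y ! i"
  proof (induction i rule: less_induct)
    case (less i)
    have "take i x = take i y"
      using less len by (intro nth_take_lemma) auto
    then show ?case
      using phase [OF less.prems] by (auto simp: phase_def)
  qed
qed

text \<open>Any vertex is turned into any other by replacing its bits from left to right; each
  replacement is a flip or changes nothing.\<close>

lemma flip_connected:
  assumes step: "\<And>i x. length x = n \<Longrightarrow> i < n \<Longrightarrow> P x \<Longrightarrow> P (flip i x)"
    and "P x" "length x = n" "length y = n"
  shows "P y"
proof -
  have "P (take k y @ drop k x)" if "k \<le> n" for k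
    using that
  proof (induction k)
    case 0
    then show ?case using assms by simp
  next
    case (Suc k)
    let ?z = "take k y @ drop k x" and ?z' = "take (Suc k) y @ drop (Suc k) x"
    have z': "?z' = ?z[k := y ! k]"
      using Suc.prems assms(3,4)
      by (simp add: take_Suc_conv_app_nth list_update_append min_def Cons_nth_drop_Suc [symmetric])
    have "y ! k = ?z ! k \<or> y ! k = (\<not> ?z ! k)"
      by blast
    then have "?z' = ?z \<or> ?z' = flip k ?z"
      unfolding z' flip_def by (elim disjE; simp only: list_update_id simp_thms)
    moreover have "P ?z" "P (flip k ?z)"
      using Suc assms(3,4) step [of ?z k] by auto
    ultimately show ?case by metis
  qed
  from this [of n] show ?thesis
    using assms by simp
qed

section \<open>Edges of the twisted cube as flips\<close>

lemma pverts_twisted_cube [simp]: "pverts (twisted_cube n) = {x. length x = n}"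
  by (simp add: twisted_cube_def)

lemma parcs_twisted_cube_iff:
  "(x, z) \<in> parcs (twisted_cube n) \<longleftrightarrow>
     length x = n \<and> (z = x \<or> (\<exists>i<n. z = flip i x \<and> \<not> phase i x))"
proof -
  have "(\<exists>y b. length y = n - 1 \<and> b = odd (count_list (take i y) False) \<and>
            x = take i y @ b # drop i y \<and> z = take i y @ (\<not> b) # drop i y) \<longleftrightarrow>
          length x = n \<and> z = flip i x \<and> \<not> phase i x" (is "?L \<longleftrightarrow> ?R") if i: "i < n" for i
  proof
    assume ?L
    then obtain y where y: "length y = n - 1"
      "x = take i y @ odd (count_list (take i y) False) # drop i y"
      "z = take i y @ even (count_list (take i y) False) # drop i y"
      by auto
    then have "length (take i y) = i"
      using i by simp
    then show ?R
      using i y by (simp add: flip_def phase_def nth_append list_update_append)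
  next
    assume ?R
    \<comment> \<open>The witness for \<open>y\<close> is \<open>x\<close> with entry
      \<open>i\<close> deleted; both have the same first \<open>i\<close> bits, hence the same
      parity.\<close>
    then have "length (take i x @ drop (Suc i) x) = n - 1"
      "x ! i = odd (count_list (take i (take i x @ drop (Suc i) x)) False)"
      "z = take i x @ (\<not> x ! i) # drop (Suc i) x"
      using i by (auto simp: phase_def flip_def upd_conv_take_nth_drop)
    moreover have "x = take i x @ x ! i # drop (Suc i) x"
      using i \<open>?R\<close> by (intro id_take_nth_drop) simp
    ultimately show ?L
      using i \<open>?R\<close>
      by (intro exI [of _ "take i x @ drop (Suc i) x"] exI [of _ "x ! i"]) auto
  qed
  then show ?thesis
    unfolding twisted_cube_def by (simp, blast)
qed

lemma edge_dim_refl [simp]: "edge_dim (x, x) = None"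
  by (simp add: edge_dim_def)

lemma edge_dim_flip:
  assumes "i < length x"
  shows "edge_dim (x, flip i x) = Some i" "edge_dim (flip i x, x) = Some i"
proof -
  have "(THE j. j < length x \<and> x ! j \<noteq> flip i x ! j) = i"
    "(THE j. j < length x \<and> flip i x ! j \<noteq> x ! j) = i"
    using assms by (auto intro!: the_equality simp: nth_flip)
  then show "edge_dim (x, flip i x) = Some i" "edge_dim (flip i x, x) = Some i"
    using flip_neq [OF assms] by (auto simp: edge_dim_def)
qed

lemma edge_flip:
  assumes "length x = n" "i < n"
  shows "(if phase i x then (flip i x, x) else (x, flip i x)) \<in> parcs (twisted_cube n)"
  using assms by (auto simp: parcs_twisted_cube_iff phase_flip)

lemma edge_dim_cases:
  assumes "(x, z) \<in> parcs (twisted_cube n)"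
  obtains "z = x" "edge_dim (x, z) = None"
  | i where "i < n" "z = flip i x" "\<not> phase i x" "edge_dim (x, z) = Some i"
  using assms by (auto simp: parcs_twisted_cube_iff edge_dim_flip)

section \<open>Existence: the prefix map\<close>

lemma graph_morphism_take:
  assumes "n \<le> m"
  shows "graph_morphism (twisted_cube m) (twisted_cube n)
           (restrict (take n) {x. length x = m})"
  unfolding graph_morphism_def
proof (intro conjI allI impI)
  fix x z
  assume e: "(x, z) \<in> parcs (twisted_cube m)"
  then have len: "length x = m" "length z = m"
    by (auto simp: parcs_twisted_cube_iff)
  from e have "(take n x, take n z) \<in> parcs (twisted_cube n)"
  proof (cases rule: edge_dim_cases)
    \<comment> \<open>The phase at \<open>i < n\<close> depends only on the prefix, so the edge
      keeps its direction; for \<open>i \<ge> n\<close> it collapses to a loop.\<close>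
    case (2 i)
    then show ?thesis
      using assms len
      by (cases "i < n") (auto simp: parcs_twisted_cube_iff take_flip take_flip_beyond phase_take)
  qed (use assms len in \<open>auto simp: parcs_twisted_cube_iff\<close>)
  then show "(restrict (take n) {x. length x = m} x, restrict (take n) {x. length x = m} z)
      \<in> parcs (twisted_cube n)"
    using len by simp
qed (use assms in auto)

lemma dimension_preserving_take:
  assumes "n \<le> m"
  shows "dimension_preserving m (restrict (take n) {x. length x = m})" (is "dimension_preserving m ?f")
proof -
  \<comment> \<open>The dimension of the image depends on the dimension of \<open>e\<close>
    alone.\<close>
  have "edge_dim (map_prod ?f ?f e) =
      (case edge_dim e of Some i \<Rightarrow> if i < n then Some i else None | None \<Rightarrow> None)"
    if "e \<in> parcs (twisted_cube m)" for e
  proof (cases e)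
    case (Pair x z)
    then have e: "(x, z) \<in> parcs (twisted_cube m)"
      using that by simp
    then have "length x = m" "length z = m"
      by (auto simp: parcs_twisted_cube_iff)
    with e show ?thesis
      unfolding Pair using assms
      by (cases rule: edge_dim_cases) (auto simp: take_flip take_flip_beyond edge_dim_flip)
  qed
  then show ?thesis
    by (simp add: dimension_preserving_def)
qed

lemma image_take_lists:
  assumes "n \<le> m"
  shows "take n ` {x :: bool list. length x = m} = {x. length x = n}"
proof -
  have "y \<in> take n ` {x. length x = m}" if "length y = n" for y :: "bool list"
    using that assms by (intro image_eqI [of _ _ "y @ replicate (m - n) False"]) auto
  then show ?thesis
    using assms by auto
qed

section \<open>Uniqueness: the induced map of dimensions\<close>

lemma dimension_map:
  assumes f: "graph_morphism (twisted_cube m) (twisted_cube n) f" "dimension_preserving m f"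
    and i: "i < m"
  shows "\<exists>d. \<forall>x. length x = m \<longrightarrow>
           (case d of None \<Rightarrow> f (flip i x) = f x
            | Some j \<Rightarrow> j < n \<and> f (flip i x) = flip j (f x) \<and> phase j (f x) = phase i x)"
proof -
  define e where "e x = (if phase i x then (flip i x, x) else (x, flip i x))" for x
  have edge: "e x \<in> parcs (twisted_cube m)" if "length x = m" for x
    using edge_flip [OF that i] by (simp add: e_def)
  have dim: "edge_dim (e x) = Some i" if "length x = m" for x
    using that i by (simp add: e_def edge_dim_flip)
  \<comment> \<open>The all-zero vertex is an arbitrary reference; by dimension preservation every
    vertex yields the same \<open>d\<close>.\<close>
  define d where "d = edge_dim (map_prod f f (e (replicate m False)))"
  have "case d of None \<Rightarrow> f (flip i x) = f x
      | Some j \<Rightarrow> j < n \<and> f (flip i x) = flip j (f x) \<and> phase j (f x) = phase i x"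
    if x: "length x = m" for x
  proof -
    obtain s t where st: "e x = (s, t)"
      by fastforce
    have d: "d = edge_dim (f s, f t)"
      using f(2) edge [OF x] dim [OF x] edge [of "replicate m False"] dim [of "replicate m False"] st
      unfolding d_def dimension_preserving_def by (metis length_replicate map_prod_simp)
    have "(f s, f t) \<in> parcs (twisted_cube n)"
      using f(1) edge [OF x] st by (simp add: graph_morphism_def)
    then have len: "length (f s) = n" and "(f s, f t) \<in> parcs (twisted_cube n)"
      by (auto simp: parcs_twisted_cube_iff)
    from this(2) show ?thesis
    proof (cases rule: edge_dim_cases)
      case 1
      then show ?thesis
        using st d by (auto simp: e_def split: if_splits)
    next
      case (2 j)
      \<comment> \<open>Sources go to sources and targets to targets, and \<open>x\<close> is
        \<open>s\<close> or \<open>t\<close> according to its phase.\<close>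
      then have "phase j (f t)"
        using len by (simp add: phase_flip)
      then show ?thesis
        using 2 st d by (auto simp: e_def split: if_splits)
    qed
  qed
  then show ?thesis
    by blast
qed

text \<open>Preimages \<open>g l\<close> of the values \<open>l \<le> j\<close> fill the initial
  segment up to \<open>g j\<close>. Since \<open>g\<close> is injective there, counting gives
  \<open>g j = j\<close>.\<close>

lemma order_reflecting_surj_id:
  fixes \<phi> :: "nat \<Rightarrow> nat option"
  assumes le_iff: "\<And>i j k. i < m \<Longrightarrow> k < m \<Longrightarrow> \<phi> i = Some j \<Longrightarrow>
      (\<exists>l\<le>j. \<phi> k = Some l) \<longleftrightarrow> k \<le> i"
    and surj: "\<And>j. j < n \<Longrightarrow> \<exists>i<m. \<phi> i = Some j"
    and "j < n"
  shows "j < m \<and> \<phi> j = Some j"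
proof -
  obtain g where g: "\<And>j. j < n \<Longrightarrow> g j < m \<and> \<phi> (g j) = Some j"
    using surj by metis
  have "{..g j} = g ` {..j}"
  proof (intro set_eqI iffI)
    fix k
    assume "k \<in> {..g j}"
    then have "k \<le> g j" "k < m"
      using g [OF \<open>j < n\<close>] by auto
    then obtain l where l: "l \<le> j" "\<phi> k = Some l"
      using le_iff g \<open>j < n\<close> by blast
    then have "l < n"
      using \<open>j < n\<close> by simp
    then have "g l < m" "\<phi> (g l) = Some l"
      using g by auto
    \<comment> \<open>Both \<open>k\<close> and \<open>g l\<close> are sent to \<open>l\<close>, so
      the equivalence gives both inequalities.\<close>
    then have "k = g l"
      using le_iff [of k "g l" l] le_iff [of "g l" k l] l \<open>k < m\<close> by auto
    then show "k \<in> g ` {..j}"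
      using l by auto
  next
    fix k
    assume "k \<in> g ` {..j}"
    then obtain l where "k = g l" "l \<le> j"
      by auto
    then show "k \<in> {..g j}"
      using g [of l] g [of j] le_iff [of "g j" k j] \<open>j < n\<close> by auto
  qed
  moreover have "inj_on g {..j}"
    by (rule inj_onI) (metis \<open>j < n\<close> atMost_iff g le_less_trans option.inject)
  ultimately have "Suc (g j) = Suc j"
    by (metis card_atMost card_image)
  then show ?thesis
    using g [OF \<open>j < n\<close>] by simp
qed

lemma surjective_morphism_eq_take:
  assumes f: "graph_morphism (twisted_cube m) (twisted_cube n) f" "dimension_preserving m f"
    and surj: "f ` pverts (twisted_cube m) = pverts (twisted_cube n)"
    and x: "length x = m"
  shows "f x = take n x"
proof -
  from choice [of "\<lambda>i d. i < m \<longrightarrow> (\<forall>x. length x = m \<longrightarrow>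
      (case d of None \<Rightarrow> f (flip i x) = f x
       | Some j \<Rightarrow> j < n \<and> f (flip i x) = flip j (f x) \<and> phase j (f x) = phase i x))"]
    dimension_map [OF f]
  obtain \<phi> where \<phi>: "\<And>i x. i < m \<Longrightarrow> length x = m \<Longrightarrow>
      (case \<phi> i of None \<Rightarrow> f (flip i x) = f x
       | Some j \<Rightarrow> j < n \<and> f (flip i x) = flip j (f x) \<and> phase j (f x) = phase i x)"
    by blast
  have len: "length (f y) = n" if "length y = m" for y
    using surj that by auto
  \<comment> \<open>The phase equation is compared at \<open>x\<close> and \<open>flip k x\<close>.
    If \<open>\<phi> k = None\<close>, the image does not move and its phase stays.\<close>
  have le_iff: "(\<exists>l\<le>j. \<phi> k = Some l) \<longleftrightarrow> k \<le> i" if "i < m" "k < m" "\<phi> i = Some j" for i j k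
    using \<phi> [OF \<open>i < m\<close> x] \<phi> [OF \<open>i < m\<close>, of "flip k x"] \<phi> [OF \<open>k < m\<close> x] that x len [OF x]
    by (auto simp: phase_flip split: option.splits)
  have surj_dim: "\<exists>i<m. \<phi> i = Some j" if j: "j < n" for j
  proof (rule ccontr)
    assume no: "\<not> (\<exists>i<m. \<phi> i = Some j)"
    \<comment> \<open>If no dimension is sent to \<open>j\<close>, no flip of the source affects bit
      \<open>j\<close> of the image, which contradicts surjectivity.\<close>
    have const: "f y ! j = f x ! j" if "length y = m" for y
    proof (rule flip_connected [where n = m and P = "\<lambda>y. f y ! j = f x ! j", OF _ refl x that])
      fix i z
      assume "length z = m" "i < m" "f z ! j = f x ! j"
      then show "f (flip i z) ! j = f x ! j"
        using \<phi> [of i z] no j len [of z] by (auto simp: nth_flip split: option.splits)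
    qed
    have "flip j (f x) \<in> f ` pverts (twisted_cube m)"
      unfolding surj using len [OF x] by simp
    then obtain y where "length y = m" "f y = flip j (f x)"
      by auto
    then show False
      using const [of y] j len [OF x] by (simp add: nth_flip)
  qed
  have "j < m \<and> \<phi> j = Some j" if "j < n" for j
    using le_iff surj_dim that by (rule order_reflecting_surj_id)
  \<comment> \<open>If \<open>m < n\<close>, then \<open>j = m\<close> would give
    \<open>m < m\<close>.\<close>
  then have id: "n \<le> m" "\<And>j. j < n \<Longrightarrow> \<phi> j = Some j"
    by (meson not_le less_irrefl)+
  show ?thesis
  proof (rule phase_eqI)
    show "length (f x) = length (take n x)"
      using id x len by simp
    show "phase j (f x) = phase j (take n x)" if "j < length (f x)" for j
      using \<phi> [of j x] id that x len [OF x] by (simp add: phase_take)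
  qed
qed

theorem theorem3p10:
  fixes m n :: nat
  assumes "m \<ge> n"
  shows "\<exists>!f. graph_morphism (twisted_cube m) (twisted_cube n) f \<and>
              dimension_preserving m f \<and>
              f ` pverts (twisted_cube m) = pverts (twisted_cube n)"
proof (rule ex1I [of _ "restrict (take n) {x. length x = m}"])
  show "graph_morphism (twisted_cube m) (twisted_cube n) (restrict (take n) {x. length x = m}) \<and>
      dimension_preserving m (restrict (take n) {x. length x = m}) \<and>
      restrict (take n) {x. length x = m} ` pverts (twisted_cube m) = pverts (twisted_cube n)"
    using assms graph_morphism_take dimension_preserving_take image_take_lists by simp
next
  fix f
  assume f: "graph_morphism (twisted_cube m) (twisted_cube n) f \<and>
      dimension_preserving m f \<and> f ` pverts (twisted_cube m) = pverts (twisted_cube n)"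
  \<comment> \<open>Both maps are \<open>undefined\<close> off the vertex set, so agreement on
    vertices suffices.\<close>
  then have "f \<in> extensional {x. length x = m}"
    by (auto simp: graph_morphism_def PiE_def)
  then show "f = restrict (take n) {x. length x = m}"
    using f surjective_morphism_eq_take by (intro extensionalityI) auto
qed

end
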